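(* Let $d\ge 1$, let $\phi:[0,1)^d\to\mathbb{R}$ be measurable, let $X=\phi(\bm u)$ with $\bm u$ uniformly distributed on $[0,1)^d$, and let $F$ be the cumulative distribution function of $X$. Let $p\in(0,1)$ and $v=F^{-1}(p)=\inf\{x\in\mathbb{R}: F(x)\ge p\}$. For each $N\ge 1$ let $\bm u_1,\dots,\bm u_N\in[0,1)^d$ be (deterministic) quasi-Monte Carlo points, let $$\hat F_N(x)=\frac1N\sum_{i=1}^N \bm 1\{\phi(\bm u_i)\le x\},\qquad x\in\mathbb{R},$$ and let $\hat v_N=\hat F_N^{-1}(p)=\inf\{x\in\mathbb{R}:\hat F_N(x)\ge p\}$. Assume that (i) $x=v$ is the unique solution $x$ of $F(x-)\le p\le F(x)$, and (ii) $\lim_{N\to\infty}\hat F_N(x)=F(x)$ for all $x\in\mathbb{R}$. Then $\hat v_N\to v$ as $N\to\infty$.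
   Context: $F(x-)$ denotes the left limit of $F$ at $x$. $\bm 1\{\cdot\}$ is the indicator function. "Quasi-Monte Carlo points" means deterministic points of $[0,1)^d$; no property of them is used other than (ii), and the point set may change with $N$. *)

theory Defs
  imports "HOL-Probability.Probability"
begin

definition unit_cube :: "(real ^ 'd) set" where
  "unit_cube = {x. \<forall>i. 0 \<le> x $ i \<and> x $ i < 1}"

text \<open>
  The left limit \<open>F(x-)\<close>. \<^const>\<open>Lim\<close> is total, so the value is meaningful only where
  the limit exists; this is everywhere for a monotone \<open>F\<close> such as a distribution function.
\<close>
definition left_limit :: "(real \<Rightarrow> real) \<Rightarrow> real \<Rightarrow> real" where
  "left_limit F x = Lim (at_left x) F"

text \<open>
  The infimum is taken in the reals; for a distribution function \<open>F\<close> and \<open>0 < p < 1\<close>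
  the set is nonempty and bounded below.
\<close>
definition quantile :: "(real \<Rightarrow> real) \<Rightarrow> real \<Rightarrow> real" where
  "quantile F p = Inf {x. F x \<ge> p}"

definition empirical_cdf :: "('a \<Rightarrow> real) \<Rightarrow> (nat \<Rightarrow> 'a) \<Rightarrow> nat \<Rightarrow> real \<Rightarrow> real" where
  "empirical_cdf \<phi> u N x = (1 / real N) * (\<Sum>i=1..N. of_bool (\<phi> (u i) \<le> x))"

end

theory Submission
  imports Defs
begin

text \<open>
  If \<open>x < v < y\<close>, then \<open>F x < p\<close> because \<open>v\<close> is the infimum of \<open>{x. F x \<ge> p}\<close>, and \<open>p < F y\<close>
  because otherwise \<open>F y = p\<close> and \<open>y\<close> would be a second solution in (i).
  By (ii), \<open>F_hat N x < p < F_hat N y\<close> for all large \<open>N\<close>, and monotonicity of the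
  empirical distribution function confines its \<open>p\<close>-quantile to \<open>[x, y]\<close>.
\<close>

lemma mono_empirical_cdf: "mono (empirical_cdf \<phi> u N)"
  unfolding empirical_cdf_def
  by (intro monoI mult_left_mono sum_mono) auto

text \<open>Each bound uses both inequalities: \<open>p \<le> G b\<close> puts \<open>b\<close> in
  the superlevel set, while \<open>G a < p\<close> and monotonicity make \<open>a\<close> a lower
  bound of it. Hence \<open>Inf\<close> is a genuine infimum.\<close>

lemma quantile_between:
  assumes "mono G" and "G a < p" and "p \<le> G b"
  shows "a \<le> quantile G p" and "quantile G p \<le> b"
proof -
  have lower: "a \<le> x" if "x \<in> {x. p \<le> G x}" for x
    using that assms(2) monoD[OF assms(1), of x a] by force
  show "a \<le> quantile G p"
    unfolding quantile_def by (rule cInf_greatest) (use lower assms(3) in auto)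
  show "quantile G p \<le> b"
    unfolding quantile_def
    by (rule cInf_lower) (use lower assms(3) in \<open>auto simp: bdd_below_def\<close>)
qed

text \<open>The left limit is the mass of the open ray \<open>{..<x}\<close>, which lies inside
  \<open>{..x}\<close>. This turns \<open>F x \<le> p\<close> into the left half of the uniqueness
  condition.\<close>

lemma (in finite_borel_measure) left_limit_cdf_le: "left_limit (cdf M) x \<le> cdf M x"
proof -
  have "left_limit (cdf M) x = measure M {..<x}"
    unfolding left_limit_def
    using cdf_at_left by (intro tendsto_Lim) auto
  also have "\<dots> \<le> cdf M x"
    unfolding cdf_def by (intro finite_measure_mono) auto
  finally show ?thesis .
qed

lemma (in real_distribution) cdf_less_below_quantile:
  assumes "0 < p" and "x < quantile (cdf M) p"
  shows "cdf M x < p"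
proof (rule ccontr)
  assume "\<not> cdf M x < p"
  \<comment> \<open>Positivity of \<open>p\<close> enters here: the distribution function tends to 0
    at minus infinity, so the superlevel set is bounded below.\<close>
  moreover obtain a where a: "cdf M a < p"
    using order_tendstoD(2)[OF cdf_lim_at_bot assms(1)]
    by (auto simp: eventually_at_bot_linorder)
  moreover have "mono (cdf M)"
    using cdf_nondecreasing by (intro monoI) auto
  ultimately have "quantile (cdf M) p \<le> x"
    by (intro quantile_between(2)) auto
  with assms(2) show False by simp
qed

lemma quantile_tendsto:
  assumes mono: "\<And>n. mono (G n)"
    and lim: "\<And>x. (\<lambda>n. G n x) \<longlonglongrightarrow> F x"
    and below: "\<And>x. x < v \<Longrightarrow> F x < p"
    and above: "\<And>x. v < x \<Longrightarrow> p < F x"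
  shows "(\<lambda>n. quantile (G n) p) \<longlonglongrightarrow> v"
proof (rule order_tendstoI)
  fix a assume "a < v"
  \<comment> \<open>\<open>quantile_between\<close> gives only weak bounds; the intermediate point
    makes the final one strict.\<close>
  then obtain b where b: "a < b" "b < v" using dense by blast
  have "\<forall>\<^sub>F n in sequentially. G n b < p"
    using order_tendstoD(2)[OF lim below[OF b(2)]] .
  \<comment> \<open>Any point right of \<open>v\<close> would do; it keeps the superlevel set of
    \<open>G n\<close> nonempty. Symmetrically, \<open>v - 1\<close> below keeps it bounded
    below.\<close>
  moreover have "\<forall>\<^sub>F n in sequentially. p < G n (v + 1)"
    using order_tendstoD(1)[OF lim above] by simp
  ultimately show "\<forall>\<^sub>F n in sequentially. a < quantile (G n) p"
  proof eventually_elim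
    case (elim n)
    then show ?case using quantile_between(1)[OF mono, of n b p "v + 1"] b by simp
  qed
next
  fix a assume "v < a"
  then obtain b where b: "v < b" "b < a" using dense by blast
  have "\<forall>\<^sub>F n in sequentially. p < G n b"
    using order_tendstoD(1)[OF lim above[OF b(1)]] .
  moreover have "\<forall>\<^sub>F n in sequentially. G n (v - 1) < p"
    using order_tendstoD(2)[OF lim below] by simp
  ultimately show "\<forall>\<^sub>F n in sequentially. quantile (G n) p < a"
  proof eventually_elim
    case (elim n)
    then show ?case using quantile_between(2)[OF mono, of n "v - 1" p b] b by simp
  qed
qed

theorem theorem3p1:
  fixes \<phi> :: "real ^ 'd \<Rightarrow> real"
    and P :: "'w measure"
    and U :: "'w \<Rightarrow> real ^ 'd"
    and X :: "'w \<Rightarrow> real"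
    and F :: "real \<Rightarrow> real"
    and p v :: real
    and u :: "nat \<Rightarrow> nat \<Rightarrow> real ^ 'd"
    and F_hat :: "nat \<Rightarrow> real \<Rightarrow> real"
    and v_hat :: "nat \<Rightarrow> real"
  assumes "\<phi> \<in> borel_measurable (restrict_space borel unit_cube)"
    and "prob_space P"
    and "U \<in> borel_measurable P"
    and "\<And>\<omega>. \<omega> \<in> space P \<Longrightarrow> U \<omega> \<in> unit_cube"
    and "distr P lborel U = uniform_measure lborel unit_cube"
    and "X = (\<lambda>\<omega>. \<phi> (U \<omega>))"
    and "F = cdf (distr P borel X)"
    and "0 < p" and "p < 1"
    and "v = quantile F p"
    and "\<And>N i. 1 \<le> N \<Longrightarrow> i \<in> {1..N} \<Longrightarrow> u N i \<in> unit_cube"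
    and "\<And>N. 1 \<le> N \<Longrightarrow> F_hat N = empirical_cdf \<phi> (u N) N"
    and "\<And>N. 1 \<le> N \<Longrightarrow> v_hat N = quantile (F_hat N) p"
    and "\<And>x. (left_limit F x \<le> p \<and> p \<le> F x) \<longleftrightarrow> x = v"
    and "\<And>x. (\<lambda>N. F_hat N x) \<longlonglongrightarrow> F x"
  shows "v_hat \<longlonglongrightarrow> v"
proof -
  \<comment> \<open>\<open>\<phi>\<close> is measurable only on the cube, so \<open>U\<close> must
    be a map into the restricted space before composing.\<close>
  have "U \<in> measurable P (restrict_space borel unit_cube)"
    using assms(3,4) by (intro measurable_restrict_space2) auto
  then have "X \<in> borel_measurable P"
    unfolding assms(6) using assms(1) by (rule measurable_compose)
  then interpret D: real_distribution "distr P borel X"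
    using assms(2) by (intro prob_space.real_distribution_distr)
  note unique = assms(14)
  have below: "F x < p" if "x < v" for x
    using D.cdf_less_below_quantile[OF assms(8)] that assms(7,10) by simp
  have above: "p < F x" if "v < x" for x
  proof -
    have "p \<le> F v" using unique by blast
    also have "F v \<le> F x"
      using D.cdf_nondecreasing that assms(7) by simp
    finally have "p \<le> F x" .
    moreover have "\<not> F x \<le> p"
      using unique[of x] \<open>p \<le> F x\<close> that D.left_limit_cdf_le[of x] assms(7) by auto
    ultimately show ?thesis by simp
  qed
  \<comment> \<open>\<open>F_hat 0\<close> is arbitrary and might fail to be monotone.
    \<open>empirical_cdf\<close> is monotone at every index (constantly 0 at \<open>N = 0\<close>),
    so the limit is proved for it and transferred to \<open>v_hat\<close>.\<close>
  have ev: "\<forall>\<^sub>F N in sequentially. F_hat N = empirical_cdf \<phi> (u N) N"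
    using assms(12) by (auto intro: eventually_sequentiallyI)
  have "(\<lambda>N. empirical_cdf \<phi> (u N) N x) \<longlonglongrightarrow> F x" for x
    using assms(15)[of x] by (rule Lim_transform_eventually) (use ev in eventually_elim, simp)
  then have "(\<lambda>N. quantile (empirical_cdf \<phi> (u N) N) p) \<longlonglongrightarrow> v"
    using mono_empirical_cdf below above by (intro quantile_tendsto) auto
  moreover have "\<forall>\<^sub>F N in sequentially. quantile (empirical_cdf \<phi> (u N) N) p = v_hat N"
    using assms(12,13) by (auto intro: eventually_sequentiallyI[of 1])
  ultimately show ?thesis
    by (rule Lim_transform_eventually)
qed

end
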